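(* Let $t$, $k$, $\lambda$, $n$ and $\ell$ be positive integers such that $2\leq t$ and $k=t+1$. Let $b_0,b_1,\ldots,b_{t+1}$ be the solution to the system of equations given by $b_{t+1}=0$ and $$b_i=\frac{\lambda\binom{\ell}{i}\binom{n-\ell}{t-i}-(i+1)b_{i+1}}{t+1-i}\quad\text{ for }i=0,1,\ldots,t.$$ If there exists a design $S_\lambda(t,k,n)$ with a (not necessarily cyclic) $\ell$-good sequencing, then $$b_0\leq \sum_{u=\ell+1}^{n-\ell}\;\sum_{v=u+\ell}^{n}\frac{\lambda\binom{v-u-1}{t-2}}{k-2}.$$
   Context: A design $S_\lambda(t,k,n)$ is a point set $V$ with $|V|=n\ge k$ together with a collection of $k$-subsets of $V$, called blocks, such that every $t$-subset of $V$ is contained in exactly $\lambda$ blocks. A sequencing of $V$ is a sequence $x_1,\ldots,x_n$ in which every element of $V$ occurs exactly once. A segment is a subsequence of consecutive entries. A sequencing is $\ell$-good if no segment of length at most $\ell$ contains all the points of a block. Empty sums are $0$. *)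

theory Defs
  imports Complex_Main "HOL-Library.Multiset" "HOL-Library.Sublist"
begin

text \<open>
  Blocks form a multiset, so repeated blocks are allowed; designs without
  repeated blocks are the special case in which every multiplicity is 1.
\<close>

definition design :: "nat \<Rightarrow> nat \<Rightarrow> nat \<Rightarrow> nat \<Rightarrow> 'a set \<Rightarrow> 'a set multiset \<Rightarrow> bool" where
  "design lam t k n V \<B> \<longleftrightarrow>
     finite V \<and> card V = n \<and> k \<le> n \<and>
     (\<forall>B\<in>#\<B>. B \<subseteq> V \<and> card B = k) \<and>
     (\<forall>T. T \<subseteq> V \<and> card T = t \<longrightarrow> size {#B \<in># \<B>. T \<subseteq> B#} = lam)"

definition sequencing :: "'a set \<Rightarrow> 'a list \<Rightarrow> bool" where
  "sequencing V xs \<longleftrightarrow> distinct xs \<and> set xs = V"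

text \<open>
  The library predicate \<^const>\<open>sublist\<close> means a contiguous sublist, i.e. a segment.
  Segments do not wrap around.
\<close>

definition good_sequencing :: "nat \<Rightarrow> 'a set \<Rightarrow> 'a set multiset \<Rightarrow> 'a list \<Rightarrow> bool" where
  "good_sequencing l V \<B> xs \<longleftrightarrow>
     sequencing V xs \<and>
     \<not> (\<exists>ys B. sublist ys xs \<and> length ys \<le> l \<and> B \<in># \<B> \<and> B \<subseteq> set ys)"

end

theory Submission
  imports Defs
begin

text \<open>
  With \<open>k = t + 1\<close>, the recursion for \<open>b\<close> is a double count.  Let \<open>L\<close> be a set of \<open>l\<close> points that
  contains no block, and count pairs of a block \<open>B\<close> and a \<open>t\<close>-set \<open>T \<subseteq> B\<close> with exactly \<open>i\<close> points
  in \<open>L\<close>.  A \<open>t\<close>-subset of \<open>B\<close> omits a single point, so only blocks with \<open>i\<close> or \<open>i + 1\<close> points in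
  \<open>L\<close> contribute, the former \<open>t + 1 - i\<close> times and the latter \<open>i + 1\<close> times.  Hence \<open>b i\<close> is the
  number of blocks that meet \<open>L\<close> in exactly \<open>i\<close> points; the initial value \<open>b (t + 1) = 0\<close> says that
  no block lies inside \<open>L\<close> (\<open>block_intersection_numbers\<close>).

  Number the points by their positions in an \<open>l\<close>-good sequencing and let \<open>L\<close> be the first \<open>l\<close>
  positions.  Then \<open>b 0\<close> counts the blocks whose first position \<open>u\<close> is greater than \<open>l\<close>, and
  goodness forces the last position \<open>v\<close> of every block to satisfy \<open>v \<ge> u + l\<close>.  A block with first
  point \<open>u\<close> and last point \<open>v\<close> contains \<open>k - 2\<close> of the \<open>t\<close>-sets that consist of \<open>u\<close>, \<open>v\<close> and
  \<open>t - 2\<close> points strictly between them.  There are \<open>(v - u - 1) choose (t - 2)\<close> such \<open>t\<close>-sets, each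
  in \<open>lam\<close> blocks, which bounds the number of these blocks by one summand of the right-hand side
  (\<open>blocks_with_given_ends\<close>).

  Both counts are instances of \<open>design_count_split\<close>.
\<close>

section \<open>Counting incidences between subsets and blocks\<close>

lemma sum_size_filter_mset_swap:
  assumes "finite S"
  shows "(\<Sum>x\<in>S. size {#B \<in># M. R x B#}) = (\<Sum>B\<in>#M. card {x\<in>S. R x B})"
proof (induction M)
  case empty
  then show ?case by simp
next
  case (add B M)
  have "(\<Sum>x\<in>S. size {#B \<in># add_mset B M. R x B#})
      = (\<Sum>x\<in>S. (if R x B then 1 else 0) + size {#B \<in># M. R x B#})"
    by (intro sum.cong) auto
  also have "\<dots> = card {x\<in>S. R x B} + (\<Sum>x\<in>S. size {#B \<in># M. R x B#})"
    using assms by (simp add: sum.distrib sum.If_cases Int_def)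
  finally show ?case using add.IH by simp
qed

lemma size_filter_mset_eq_sum_mset:
  "size (filter_mset P M) = (\<Sum>B\<in>#M. if P B then 1 else 0)"
  by (induction M) auto

lemma card_subsets_split:
  assumes "finite P" "finite Q" "P \<inter> Q = {}"
  shows "card {T. T \<subseteq> P \<union> Q \<and> card (T \<inter> P) = i \<and> card (T \<inter> Q) = j}
       = (card P choose i) * (card Q choose j)"
proof -
  let ?A = "{T. T \<subseteq> P \<union> Q \<and> card (T \<inter> P) = i \<and> card (T \<inter> Q) = j}"
  let ?X = "{X. X \<subseteq> P \<and> card X = i}" and ?Y = "{Y. Y \<subseteq> Q \<and> card Y = j}"
  have split: "(X \<union> Y) \<inter> P = X" "(X \<union> Y) \<inter> Q = Y" if "X \<subseteq> P" "Y \<subseteq> Q" for X Y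
    using that assms(3) by blast+
  have "bij_betw (\<lambda>T. (T \<inter> P, T \<inter> Q)) ?A (?X \<times> ?Y)"
  proof (rule bij_betw_byWitness[where f' = "\<lambda>(X, Y). X \<union> Y"])
    show "\<forall>T\<in>?A. (\<lambda>(X, Y). X \<union> Y) (T \<inter> P, T \<inter> Q) = T"
      by auto
    show "\<forall>z\<in>?X \<times> ?Y. (\<lambda>T. (T \<inter> P, T \<inter> Q)) ((\<lambda>(X, Y). X \<union> Y) z) = z"
      using split by auto
    show "(\<lambda>T. (T \<inter> P, T \<inter> Q)) ` ?A \<subseteq> ?X \<times> ?Y"
      by (rule image_subsetI) simp
    show "(\<lambda>(X, Y). X \<union> Y) ` (?X \<times> ?Y) \<subseteq> ?A"
      by (rule image_subsetI) (auto simp: split)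
  qed
  then have "card ?A = card (?X \<times> ?Y)"
    by (rule bij_betw_same_card)
  then show ?thesis
    using assms by (simp add: card_cartesian_product n_subsets)
qed

text \<open>
  Count the pairs of a block \<open>B\<close> and a \<open>t\<close>-set \<open>T \<subseteq> B\<close> that consists of \<open>i\<close> points of \<open>P\<close> and \<open>j\<close>
  points of \<open>Q\<close>: by blocks on the left, by \<open>t\<close>-sets on the right.
\<close>

lemma design_count_split:
  assumes design: "design lam t k n V M"
    and sub: "P \<subseteq> V" "Q \<subseteq> V" and disj: "P \<inter> Q = {}" and t: "i + j = t"
  shows "(\<Sum>B\<in>#M. (card (B \<inter> P) choose i) * (card (B \<inter> Q) choose j))
       = lam * (card P choose i) * (card Q choose j)"
proof -
  have "finite V"
    using design by (simp add: design_def)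
  then have fin: "finite P" "finite Q"
    using sub finite_subset by blast+
  define S where "S = {T. T \<subseteq> P \<union> Q \<and> card (T \<inter> P) = i \<and> card (T \<inter> Q) = j}"
  have card_S: "card S = (card P choose i) * (card Q choose j)"
    unfolding S_def using fin disj by (rule card_subsets_split)
  have finS: "finite S"
    unfolding S_def using fin by (auto intro: finite_subset[of _ "Pow (P \<union> Q)"])
  have "size {#B \<in># M. T \<subseteq> B#} = lam" if "T \<in> S" for T
  proof -
    have T: "T = (T \<inter> P) \<union> (T \<inter> Q)"
      using that by (auto simp: S_def)
    have "card T = card (T \<inter> P) + card (T \<inter> Q)"
      by (subst T, rule card_Un_disjoint) (use fin disj in auto)
    moreover have "T \<subseteq> V"
      using that sub by (auto simp: S_def)
    ultimately show ?thesis
      using design that t by (auto simp: design_def S_def)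
  qed
  then have "lam * card S = (\<Sum>T\<in>S. size {#B \<in># M. T \<subseteq> B#})"
    by simp
  also have "\<dots> = (\<Sum>B\<in>#M. card {T\<in>S. T \<subseteq> B})"
    using finS by (rule sum_size_filter_mset_swap)
  also have "\<dots> = (\<Sum>B\<in>#M. (card (B \<inter> P) choose i) * (card (B \<inter> Q) choose j))"
  proof (intro arg_cong[where f = sum_mset] image_mset_cong)
    fix B
    have "{T\<in>S. T \<subseteq> B} = {T. T \<subseteq> (B \<inter> P) \<union> (B \<inter> Q) \<and>
        card (T \<inter> (B \<inter> P)) = i \<and> card (T \<inter> (B \<inter> Q)) = j}"
    proof (rule set_eqI)
      fix T
      show "T \<in> {T\<in>S. T \<subseteq> B} \<longleftrightarrow> T \<in> {T. T \<subseteq> (B \<inter> P) \<union> (B \<inter> Q) \<and>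
          card (T \<inter> (B \<inter> P)) = i \<and> card (T \<inter> (B \<inter> Q)) = j}"
      proof (cases "T \<subseteq> B")
        case True
        then have "T \<inter> (B \<inter> P) = T \<inter> P" "T \<inter> (B \<inter> Q) = T \<inter> Q"
          "T \<subseteq> (B \<inter> P) \<union> (B \<inter> Q) \<longleftrightarrow> T \<subseteq> P \<union> Q"
          by blast+
        then show ?thesis
          using True by (simp add: S_def)
      qed auto
    qed
    moreover have "card \<dots> = (card (B \<inter> P) choose i) * (card (B \<inter> Q) choose j)"
      by (rule card_subsets_split) (use fin disj in auto)
    ultimately show "card {T\<in>S. T \<subseteq> B}
        = (card (B \<inter> P) choose i) * (card (B \<inter> Q) choose j)"
      by simp
  qed
  finally show ?thesis
    unfolding card_S mult.assoc by (rule sym)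
qed

section \<open>Blocks meeting a block-free set in a given number of points\<close>

text \<open>
  If \<open>B\<close> has \<open>t + 1\<close> points, \<open>c\<close> of them in \<open>L\<close>, then this is the number of its \<open>t\<close>-subsets with
  \<open>i\<close> points in \<open>L\<close>: the omitted point lies outside \<open>L\<close> if \<open>c = i\<close> and inside \<open>L\<close> if \<open>c = i + 1\<close>.
\<close>

lemma choose_split_codim_1:
  fixes c i t :: nat
  assumes "c \<le> t + 1" "i \<le> t"
  shows "(c choose i) * ((t + 1 - c) choose (t - i))
       = (t + 1 - i) * (if c = i then 1 else 0) + (i + 1) * (if c = i + 1 then 1 else 0)"
proof -
  consider "c < i" | "c = i" | "c = i + 1" | "c > i + 1"
    by linarith
  then show ?thesis
  proof cases
    case 2
    have "(Suc (t - i)) choose (t - i) = Suc (t - i)"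
      by simp
    then show ?thesis
      using 2 assms by (simp add: Suc_diff_le)
  next
    case 4
    then have "t + 1 - c < t - i"
      using assms by linarith
    then show ?thesis
      using 4 by (simp add: binomial_eq_0)
  qed (use assms in \<open>auto simp: binomial_eq_0\<close>)
qed

lemma intersection_number_recursion:
  assumes design: "design lam t (t + 1) n V M" and L: "L \<subseteq> V" and i: "i \<le> t"
  shows "(t + 1 - i) * size {#B \<in># M. card (B \<inter> L) = i#}
       + (i + 1) * size {#B \<in># M. card (B \<inter> L) = i + 1#}
       = lam * (card L choose i) * ((n - card L) choose (t - i))"
proof -
  have fin: "finite V" and n: "card V = n"
    and B: "\<And>B. B \<in># M \<Longrightarrow> B \<subseteq> V \<and> card B = t + 1"
    using design by (auto simp: design_def)
  have finL: "finite L"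
    using L fin finite_subset by blast
  have "(\<Sum>B\<in>#M. (card (B \<inter> L) choose i) * (card (B \<inter> (V - L)) choose (t - i)))
      = (\<Sum>B\<in>#M. (t + 1 - i) * (if card (B \<inter> L) = i then 1 else 0)
                + (i + 1) * (if card (B \<inter> L) = i + 1 then 1 else 0))"
  proof (intro arg_cong[where f = sum_mset] image_mset_cong)
    fix B assume BM: "B \<in># M"
    have finB: "finite B"
      using B[OF BM] fin finite_subset by blast
    have "B \<inter> (V - L) = B - B \<inter> L"
      using B[OF BM] by blast
    then have "card (B \<inter> (V - L)) = t + 1 - card (B \<inter> L)"
      using finB B[OF BM] by (simp add: card_Diff_subset)
    moreover have "card (B \<inter> L) \<le> t + 1"
      using B[OF BM] card_mono[OF finB, of "B \<inter> L"] by simp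
    ultimately show "(card (B \<inter> L) choose i) * (card (B \<inter> (V - L)) choose (t - i))
        = (t + 1 - i) * (if card (B \<inter> L) = i then 1 else 0)
        + (i + 1) * (if card (B \<inter> L) = i + 1 then 1 else 0)"
      using choose_split_codim_1[OF _ i, of "card (B \<inter> L)"] by simp
  qed
  also have "\<dots> = (t + 1 - i) * size {#B \<in># M. card (B \<inter> L) = i#}
       + (i + 1) * size {#B \<in># M. card (B \<inter> L) = i + 1#}"
    by (simp only: size_filter_mset_eq_sum_mset sum_mset.distrib sum_mset_distrib_left)
  finally have "\<dots> = (\<Sum>B\<in>#M. (card (B \<inter> L) choose i) * (card (B \<inter> (V - L)) choose (t - i)))"
    by simp
  also have "\<dots> = lam * (card L choose i) * (card (V - L) choose (t - i))"
    by (rule design_count_split[OF design L]) (use i in auto)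
  also have "card (V - L) = n - card L"
    using L finL n by (simp add: card_Diff_subset)
  finally show ?thesis .
qed

text \<open>
  The recursion determines \<open>b\<close> from \<open>b (t + 1)\<close> downwards, and the intersection numbers satisfy it;
  that \<open>L\<close> contains no block makes the initial values agree.
\<close>

lemma block_intersection_numbers:
  fixes b :: "nat \<Rightarrow> real"
  assumes design: "design lam t (t + 1) n V M" and L: "L \<subseteq> V" "card L = l"
    and no_block: "\<And>B. B \<in># M \<Longrightarrow> \<not> B \<subseteq> L"
    and b_top: "b (t + 1) = 0"
    and b_rec: "\<And>i. i \<le> t \<Longrightarrow>
      b i = (real lam * real (l choose i) * real ((n - l) choose (t - i))
              - real (i + 1) * b (i + 1)) / real (t + 1 - i)"
    and "i \<le> t + 1"
  shows "b i = real (size {#B \<in># M. card (B \<inter> L) = i#})"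
  using \<open>i \<le> t + 1\<close>
proof (induction rule: inc_induct)
  case base
  have "card (B \<inter> L) \<noteq> t + 1" if "B \<in># M" for B
  proof
    assume "card (B \<inter> L) = t + 1"
    moreover have "finite B" "card B = t + 1"
      using design that by (auto simp: design_def intro: finite_subset)
    ultimately have "B \<inter> L = B"
      by (intro card_subset_eq) auto
    then show False
      using no_block[OF that] by blast
  qed
  then have "{#B \<in># M. card (B \<inter> L) = t + 1#} = {#}"
    by (simp add: filter_mset_eq_conv)
  then show ?case
    using b_top by simp
next
  case (step i)
  then have i: "i \<le> t"
    by simp
  define N where "N = (\<lambda>i. size {#B \<in># M. card (B \<inter> L) = i#})"
  have "(t + 1 - i) * N i + (i + 1) * N (i + 1) = lam * (l choose i) * ((n - l) choose (t - i))"
    using intersection_number_recursion[OF design L(1) i] L(2) by (simp add: N_def)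
  then have "real ((t + 1 - i) * N i + (i + 1) * N (i + 1))
      = real (lam * (l choose i) * ((n - l) choose (t - i)))"
    by (simp only:)
  then have "real (t + 1 - i) * real (N i)
      = real lam * real (l choose i) * real ((n - l) choose (t - i)) - real (i + 1) * real (N (i + 1))"
    by (simp only: of_nat_add of_nat_mult)
  moreover have "b (i + 1) = real (N (i + 1))"
    using step.IH by (simp add: N_def)
  ultimately have "b i = real (t + 1 - i) * real (N i) / real (t + 1 - i)"
    using b_rec[OF i] by simp
  also have "\<dots> = real (N i)"
    using i by simp
  finally show ?case
    by (simp add: N_def)
qed

section \<open>Blocks with prescribed first and last positions\<close>

text \<open>
  Apply the count to \<open>P = {u, v}\<close> and \<open>Q = {u<..<v}\<close>: a block with ends \<open>u\<close> and \<open>v\<close> has its other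
  \<open>t - 1\<close> points in \<open>Q\<close> and contributes \<open>(t - 1) choose (t - 2) = t - 1\<close>.  Other blocks through
  \<open>u\<close> and \<open>v\<close> may contribute too, hence only an inequality.
\<close>

lemma blocks_with_given_ends:
  assumes design: "design lam t (t + 1) n {1..n} M" and t: "2 \<le> t"
    and uv: "1 \<le> u" "u < v" "v \<le> n"
  shows "(t - 1) * size {#B \<in># M. Min B = u \<and> Max B = v#} \<le> lam * ((v - u - 1) choose (t - 2))"
proof -
  have "(t - 1) * size {#B \<in># M. Min B = u \<and> Max B = v#}
      = (\<Sum>B\<in>#M. (t - 1) * (if Min B = u \<and> Max B = v then 1 else 0))"
    by (simp only: size_filter_mset_eq_sum_mset sum_mset_distrib_left)
  also have "\<dots> \<le> (\<Sum>B\<in>#M. (card (B \<inter> {u, v}) choose 2) * (card (B \<inter> {u<..<v}) choose (t - 2)))"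
  proof (rule sum_mset_mono)
    fix B assume "B \<in># M"
    then have card_B: "card B = t + 1" and finB: "finite B"
      using design by (auto simp: design_def intro: finite_subset)
    show "(t - 1) * (if Min B = u \<and> Max B = v then 1 else 0)
        \<le> (card (B \<inter> {u, v}) choose 2) * (card (B \<inter> {u<..<v}) choose (t - 2))"
    proof (cases "Min B = u \<and> Max B = v")
      case True
      have ne: "B \<noteq> {}"
        using card_B by auto
      have ends: "u \<in> B" "v \<in> B"
        using Min_in[OF finB ne] Max_in[OF finB ne] True by auto
      have B_range: "u \<le> x" "x \<le> v" if "x \<in> B" for x
        using True that finB Min_le Max_ge by auto
      have "x \<in> {u<..<v} \<longleftrightarrow> x \<notin> {u, v}" if "x \<in> B" for x
        using B_range[OF that] by auto
      then have inner: "B \<inter> {u<..<v} = B - {u, v}"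
        by blast
      have "card (B \<inter> {u<..<v}) = t - 1"
        unfolding inner using ends finB card_B uv by (simp add: card_Diff_subset)
      moreover have "B \<inter> {u, v} = {u, v}"
        using ends by auto
      then have "card (B \<inter> {u, v}) = 2"
        using uv by simp
      moreover have "(t - 1) choose (t - 2) = t - 1"
      proof -
        have "t - 1 = Suc (t - 2)"
          using t by simp
        then show ?thesis
          by (metis binomial_Suc_n)
      qed
      ultimately show ?thesis
        by simp
    qed auto
  qed
  also have "\<dots> = lam * (card {u, v} choose 2) * (card {u<..<v} choose (t - 2))"
    by (rule design_count_split[OF design]) (use uv t in auto)
  also have "\<dots> = lam * ((v - u - 1) choose (t - 2))"
    using uv by (simp add: numeral_2_eq_2)
  finally show ?thesis .
qed

text \<open>
  Goodness appears here as the statement that no block fits into \<open>l\<close> consecutive positions, so every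
  block extends at least from its first position \<open>u\<close> to \<open>u + l\<close>.
\<close>

lemma blocks_avoiding_initial_segment_le:
  assumes design: "design lam t (t + 1) n {1..n} M" and t: "2 \<le> t" and l: "0 < l"
    and spread: "\<And>B a. B \<in># M \<Longrightarrow> \<not> B \<subseteq> {a..<a + l}"
  shows "real (size {#B \<in># M. card (B \<inter> {1..l}) = 0#})
       \<le> (\<Sum>u = l + 1..n - l. \<Sum>v = u + l..n.
            real lam * real ((v - u - 1) choose (t - 2)) / real (t - 1))"
proof -
  let ?S = "SIGMA u:{l + 1..n - l}. {u + l..n}"
  let ?ends = "\<lambda>(u, v) B. Min B = u \<and> Max B = v"
  have "size {#B \<in># M. card (B \<inter> {1..l}) = 0#}
      = (\<Sum>B\<in>#M. if card (B \<inter> {1..l}) = 0 then 1 else 0)"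
    by (rule size_filter_mset_eq_sum_mset)
  also have "\<dots> \<le> (\<Sum>B\<in>#M. card {p\<in>?S. ?ends p B})"
  proof (rule sum_mset_mono)
    fix B assume BM: "B \<in># M"
    then have card_B: "card B = t + 1" and B_sub: "B \<subseteq> {1..n}"
      using design by (auto simp: design_def)
    have finB: "finite B"
      using B_sub finite_subset by blast
    have ne: "B \<noteq> {}"
      using card_B by auto
    have Min_B: "Min B \<in> B" and Max_B: "Max B \<in> B"
      using finB ne by auto
    have "Min B + l \<le> Max B"
    proof (rule ccontr)
      assume "\<not> Min B + l \<le> Max B"
      then have "x \<in> {Min B..<Min B + l}" if "x \<in> B" for x
        using Min_le[OF finB that] Max_ge[OF finB that] by simp
      then show False
        using spread[OF BM] by blast
    qed
    moreover have "Max B \<le> n"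
      using Max_B B_sub by auto
    moreover have "l + 1 \<le> Min B" if "card (B \<inter> {1..l}) = 0"
    proof -
      have "B \<inter> {1..l} = {}"
        using that by simp
      then have "Min B \<notin> {1..l}"
        using Min_B by blast
      moreover have "1 \<le> Min B"
        using Min_B B_sub by auto
      ultimately show ?thesis
        by simp
    qed
    ultimately have ends: "(Min B, Max B) \<in> {p\<in>?S. ?ends p B}" if "card (B \<inter> {1..l}) = 0"
      using that by auto
    have "finite {p\<in>?S. ?ends p B}"
      by (rule finite_subset[of _ ?S]) auto
    then have "1 \<le> card {p\<in>?S. ?ends p B}" if "card (B \<inter> {1..l}) = 0"
      using card_mono[of _ "{(Min B, Max B)}"] ends[OF that] by simp
    then show "(if card (B \<inter> {1..l}) = 0 then 1 else 0) \<le> card {p\<in>?S. ?ends p B}"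
      by simp
  qed
  also have "\<dots> = (\<Sum>p\<in>?S. size {#B \<in># M. ?ends p B#})"
    by (rule sum_size_filter_mset_swap[symmetric]) simp
  also have "\<dots> = (\<Sum>u = l + 1..n - l. \<Sum>v = u + l..n. size {#B \<in># M. Min B = u \<and> Max B = v#})"
    by (subst sum.Sigma) (auto intro!: sum.cong)
  finally have "real (size {#B \<in># M. card (B \<inter> {1..l}) = 0#})
      \<le> (\<Sum>u = l + 1..n - l. \<Sum>v = u + l..n. real (size {#B \<in># M. Min B = u \<and> Max B = v#}))"
    by (simp only: of_nat_sum[symmetric] of_nat_le_iff)
  also have "\<dots> \<le> (\<Sum>u = l + 1..n - l. \<Sum>v = u + l..n.
            real lam * real ((v - u - 1) choose (t - 2)) / real (t - 1))"
  proof (intro sum_mono)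
    fix u v assume "u \<in> {l + 1..n - l}" "v \<in> {u + l..n}"
    then have "(t - 1) * size {#B \<in># M. Min B = u \<and> Max B = v#}
        \<le> lam * ((v - u - 1) choose (t - 2))"
      using l by (intro blocks_with_given_ends[OF design t]) auto
    then have "real ((t - 1) * size {#B \<in># M. Min B = u \<and> Max B = v#})
        \<le> real (lam * ((v - u - 1) choose (t - 2)))"
      by (simp only: of_nat_le_iff)
    then show "real (size {#B \<in># M. Min B = u \<and> Max B = v#})
        \<le> real lam * real ((v - u - 1) choose (t - 2)) / real (t - 1)"
      using t by (simp add: pos_le_divide_eq mult.commute)
  qed
  finally show ?thesis .
qed

section \<open>Replacing points by their positions\<close>

lemma design_pullback:
  assumes design: "design lam t k n V M" and f: "bij_betw f A V"
  shows "design lam t k n A (image_mset (\<lambda>B. A \<inter> f -` B) M)"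
proof -
  have fin: "finite A" and n: "card A = n"
    using design f bij_betw_finite bij_betw_same_card by (fastforce simp: design_def)+
  have inj: "inj_on f A" and img: "f ` A = V"
    using f by (auto simp: bij_betw_def)
  have card_block: "card (A \<inter> f -` B) = k" if "B \<in># M" for B
  proof -
    have "B \<subseteq> V" "card B = k"
      using design that by (auto simp: design_def)
    moreover have "f ` (A \<inter> f -` B) = B"
      using \<open>B \<subseteq> V\<close> img by auto
    moreover have "inj_on f (A \<inter> f -` B)"
      using inj by (rule inj_on_subset) auto
    ultimately show ?thesis
      using card_image by metis
  qed
  have "size {#B \<in># image_mset (\<lambda>B. A \<inter> f -` B) M. T \<subseteq> B#} = lam"
    if "T \<subseteq> A" "card T = t" for T
  proof -
    have "{#B \<in># M. T \<subseteq> A \<inter> f -` B#} = {#B \<in># M. f ` T \<subseteq> B#}"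
      using that by (intro filter_mset_cong) auto
    moreover have "f ` T \<subseteq> V" "card (f ` T) = t"
      using that img inj by (auto simp: card_image inj_on_subset)
    ultimately show ?thesis
      using design by (simp add: design_def filter_mset_image_mset)
  qed
  then show ?thesis
    using fin n card_block design by (auto simp: design_def)
qed

text \<open>
  A window \<open>{a..<a + l}\<close> of positions may overhang the sequence at either end; the overhang contains
  no points, so the part of the window that matters is still a segment of length at most \<open>l\<close>.
\<close>

lemma good_sequencing_spread:
  assumes good: "good_sequencing l V M xs" and B: "B \<in># M" "B \<subseteq> V"
  shows "\<not> {1..length xs} \<inter> (\<lambda>i. xs ! (i - 1)) -` B \<subseteq> {a..<a + l}"
proof
  assume window: "{1..length xs} \<inter> (\<lambda>i. xs ! (i - 1)) -` B \<subseteq> {a..<a + l}"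
  let ?ys = "take l (drop (a - 1) xs)"
  have "B \<subseteq> set ?ys"
  proof
    fix x assume x: "x \<in> B"
    then have "x \<in> set xs"
      using B good by (auto simp: good_sequencing_def sequencing_def)
    then obtain i where i: "i < length xs" "xs ! i = x"
      by (auto simp: in_set_conv_nth)
    then have "i + 1 \<in> {a..<a + l}"
      using x by (intro subsetD[OF window]) auto
    then have "i - (a - 1) < length ?ys" "?ys ! (i - (a - 1)) = x"
      using i by auto
    then show "x \<in> set ?ys"
      by (metis nth_mem)
  qed
  moreover have "sublist ?ys xs"
    using sublist_take sublist_drop by (rule sublist_order.order_trans)
  moreover have "length ?ys \<le> l"
    by simp
  ultimately show False
    using good B by (auto simp: good_sequencing_def)
qed

section \<open>The necessary condition for a good sequencing\<close>

theorem theorem17: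
  fixes t k lam n l :: nat and b :: "nat \<Rightarrow> real"
  assumes "0 < t" and "0 < k" and "0 < lam" and "0 < n" and "0 < l"
    and "2 \<le> t" and "k = t + 1"
    and "b (t + 1) = 0"
    and "\<And>i. i \<le> t \<Longrightarrow>
      b i = (real lam * real (l choose i) * real ((n - l) choose (t - i))
              - real (i + 1) * b (i + 1)) / real (t + 1 - i)"
    and "\<exists>(V :: 'a set) \<B> xs. design lam t k n V \<B> \<and> good_sequencing l V \<B> xs"
  shows "b 0 \<le> (\<Sum>u = l + 1..n - l. \<Sum>v = u + l..n.
      real lam * real ((v - u - 1) choose (t - 2)) / real (k - 2))"
proof -
  obtain V :: "'a set" and \<B> xs where des: "design lam t (t + 1) n V \<B>"
    and good: "good_sequencing l V \<B> xs"
    using assms by blast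
  define f where "f = (\<lambda>i. xs ! (i - 1))"
  have xs: "distinct xs" "set xs = V" and len: "length xs = n"
    using good des distinct_card[of xs]
    by (auto simp: good_sequencing_def sequencing_def design_def)
  have "bij_betw (\<lambda>i. i - 1) {1..n} {..<n}"
    by (rule bij_betw_byWitness[where f' = Suc]) auto
  moreover have "bij_betw ((!) xs) {..<n} V"
    using bij_betw_nth[of xs "{..<n}" V] xs len by simp
  ultimately have f_bij: "bij_betw f {1..n} V"
    unfolding f_def using bij_betw_trans by (fastforce simp: comp_def)
  define M where "M = image_mset (\<lambda>B. {1..n} \<inter> f -` B) \<B>"
  have design: "design lam t (t + 1) n {1..n} M"
    unfolding M_def using des f_bij by (rule design_pullback)
  have spread: "\<not> B \<subseteq> {a..<a + l}" if "B \<in># M" for B a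
  proof -
    obtain B' where B': "B' \<in># \<B>" "B = {1..n} \<inter> f -` B'"
      using \<open>B \<in># M\<close> unfolding M_def set_image_mset by blast
    moreover have "B' \<subseteq> V"
      using des B' by (simp add: design_def)
    ultimately show ?thesis
      using good_sequencing_spread[OF good] len by (simp add: f_def)
  qed
  \<comment> \<open>If \<open>n < l\<close>, the whole sequence is a forbidden segment, whereas \<open>lam > 0\<close> forces a block.\<close>
  have "l \<le> n"
  proof (rule ccontr)
    assume "\<not> l \<le> n"
    have "t \<le> n"
      using design by (simp add: design_def)
    then have "size {#B \<in># M. {1..t} \<subseteq> B#} = lam"
      using design by (auto simp: design_def)
    then obtain B where B: "B \<in># M"
      using \<open>0 < lam\<close> by (metis filter_empty_mset less_irrefl multiset_nonemptyE size_empty)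
    then have "B \<subseteq> {1..<1 + l}"
      using design \<open>\<not> l \<le> n\<close> by (fastforce simp: design_def)
    then show False
      using spread[OF B] by blast
  qed
  have "b 0 = real (size {#B \<in># M. card (B \<inter> {1..l}) = 0#})"
  proof (rule block_intersection_numbers[OF design])
    show "\<not> B \<subseteq> {1..l}" if "B \<in># M" for B
      using spread[OF that, of 1] by (simp add: atLeastLessThanSuc_atLeastAtMost)
  qed (use \<open>l \<le> n\<close> assms in auto)
  also have "\<dots> \<le> (\<Sum>u = l + 1..n - l. \<Sum>v = u + l..n.
      real lam * real ((v - u - 1) choose (t - 2)) / real (t - 1))"
    using design \<open>2 \<le> t\<close> \<open>0 < l\<close> spread by (rule blocks_avoiding_initial_segment_le)
  finally show ?thesis
    using \<open>k = t + 1\<close> by simp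
qed

end
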